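(* Let $\Lambda$ be an index set and let $S_i$ be a classical semiring for each $i\in\Lambda$. Then the direct product $\prod_{i\in\Lambda}S_i$ is a classical semiring.
   Context: A semiring is an algebraic structure $(S,+,\cdot,0,1)$ such that $(S,+,0)$ and $(S,\cdot,1)$ are commutative monoids, multiplication distributes over addition, and $s\cdot 0=0$ for all $s\in S$. An element $s\in S$ is a unit if $st=1$ for some $t\in S$; it is a zero-divisor if $sx=0$ for some nonzero $x\in S$. A semiring is classical if each of its elements is either a unit or a zero-divisor. Operations on the direct product are componentwise. *)

theory Defs
  imports "HOL-Algebra.Ring"
begin

text \<open>Note that \<open>\<zero>\<close> counts as a zero-divisor as soon as the semiring has a nonzero element.\<close>

definition zero_divisor :: "('a, 'm) ring_scheme \<Rightarrow> 'a \<Rightarrow> bool" where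
  "zero_divisor R s \<longleftrightarrow>
     s \<in> carrier R \<and> (\<exists>x \<in> carrier R. x \<noteq> \<zero>\<^bsub>R\<^esub> \<and> s \<otimes>\<^bsub>R\<^esub> x = \<zero>\<^bsub>R\<^esub>)"

text \<open>Semirings are understood to be commutative, and \<open>\<zero> = \<one>\<close> is allowed. The library locale
  \<open>semiring\<close> leaves multiplication noncommutative, so \<open>comm_monoid\<close> is added for
  multiplication.\<close>

locale classical_semiring = semiring R + comm_monoid R for R (structure) +
  assumes unit_or_zero_divisor: "s \<in> carrier R \<Longrightarrow> s \<in> Units R \<or> zero_divisor R s"

text \<open>Elements of the product are extensional functions, as in the library's
  \<open>product_group\<close>; the factors may have different carriers inside the type \<open>'a\<close>.\<close>

definition product_semiring :: "'i set \<Rightarrow> ('i \<Rightarrow> ('a, 'm) ring_scheme) \<Rightarrow> ('i \<Rightarrow> 'a) ring" where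
  "product_semiring I S =
     \<lparr>carrier = (\<Pi>\<^sub>E i\<in>I. carrier (S i)),
      monoid.mult = (\<lambda>x y. \<lambda>i\<in>I. x i \<otimes>\<^bsub>S i\<^esub> y i),
      one = (\<lambda>i\<in>I. \<one>\<^bsub>S i\<^esub>),
      zero = (\<lambda>i\<in>I. \<zero>\<^bsub>S i\<^esub>),
      add = (\<lambda>x y. \<lambda>i\<in>I. x i \<oplus>\<^bsub>S i\<^esub> y i)\<rparr>"

end

theory Submission
  imports Defs
begin

text \<open>
  The semiring laws hold in a direct product because they hold in each coordinate. Classicality
  passes to the product because a unit is an element with an inverse in every coordinate, whereas
  one coordinate that is a zero-divisor already makes the whole element a zero-divisor.
  Let \<open>s\<close> be an element of
  the product. If every \<open>s i\<close> is a unit, then a choice of inverses is an inverse of \<open>s\<close>.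
  Otherwise some \<open>s j\<close> is not a unit, so it is a zero-divisor because \<open>S j\<close> is classical, and
  an annihilator \<open>x \<noteq> \<zero>\<close> of \<open>s j\<close>, extended by \<open>\<zero>\<close> to the other coordinates, is a nonzero
  annihilator of \<open>s\<close>. These two observations are the lemmas \<open>Units_product_semiringI\<close> and
  \<open>zero_divisor_product_semiringI\<close>.
\<close>

lemma product_semiring_simps:
  "carrier (product_semiring I S) = (\<Pi>\<^sub>E i\<in>I. carrier (S i))"
  "x \<otimes>\<^bsub>product_semiring I S\<^esub> y = (\<lambda>i\<in>I. x i \<otimes>\<^bsub>S i\<^esub> y i)"
  "x \<oplus>\<^bsub>product_semiring I S\<^esub> y = (\<lambda>i\<in>I. x i \<oplus>\<^bsub>S i\<^esub> y i)"
  "\<one>\<^bsub>product_semiring I S\<^esub> = (\<lambda>i\<in>I. \<one>\<^bsub>S i\<^esub>)"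
  "\<zero>\<^bsub>product_semiring I S\<^esub> = (\<lambda>i\<in>I. \<zero>\<^bsub>S i\<^esub>)"
  by (simp_all add: product_semiring_def)

text \<open>This instance of \<open>PiE_mem\<close> fixes the shape of the family, so that the simplifier can use it as
  a conditional rewrite rule for membership of a coordinate.\<close>

lemma PiE_carrier_mem:
  "x \<in> (\<Pi>\<^sub>E i\<in>I. carrier (S i)) \<Longrightarrow> i \<in> I \<Longrightarrow> x i \<in> carrier (S i)"
  by (rule PiE_mem)

lemma semiring_product_semiring:
  assumes "\<And>i. i \<in> I \<Longrightarrow> semiring (S i)"
  shows "semiring (product_semiring I S)"
proof -
  let ?P = "product_semiring I S"
  have add: "abelian_monoid (S i)" and mult: "monoid (S i)" if "i \<in> I" for i
    using semiring.axioms[OF assms[OF that]] by auto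
  note coord = PiE_carrier_mem
    abelian_monoid.a_closed[OF add] abelian_monoid.zero_closed[OF add]
    abelian_monoid.a_assoc[OF add] abelian_monoid.l_zero[OF add]
    monoid.m_closed[OF mult] monoid.one_closed[OF mult] monoid.m_assoc[OF mult]
    monoid.l_one[OF mult] monoid.r_one[OF mult]
    semiring.l_distr[OF assms] semiring.r_distr[OF assms]
    semiring.l_null[OF assms] semiring.r_null[OF assms]
  have "abelian_monoid ?P"
    by (rule abelian_monoidI)
      (auto simp: product_semiring_simps coord
        intro!: restrict_ext PiE_ext[of _ I] abelian_monoid.a_comm[OF add])
  moreover have "monoid ?P"
    by (rule monoidI)
      (auto simp: product_semiring_simps coord intro!: restrict_ext PiE_ext[of _ I])
  moreover have "semiring_axioms ?P"
    by unfold_locales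
      (auto simp: product_semiring_simps coord intro!: restrict_ext)
  ultimately show ?thesis
    by (rule semiring.intro)
qed

lemma comm_monoid_product_semiring:
  assumes "\<And>i. i \<in> I \<Longrightarrow> semiring (S i)" "\<And>i. i \<in> I \<Longrightarrow> comm_monoid (S i)"
  shows "comm_monoid (product_semiring I S)"
proof -
  interpret semiring "product_semiring I S"
    using assms(1) by (rule semiring_product_semiring)
  show ?thesis
    by unfold_locales
      (auto simp: product_semiring_simps PiE_carrier_mem intro!: restrict_ext comm_monoid.m_comm assms(2))
qed

lemma Units_product_semiringI:
  assumes "s \<in> (\<Pi>\<^sub>E i\<in>I. Units (S i))"
  shows "s \<in> Units (product_semiring I S)"
proof -
  obtain t where t: "\<And>i. i \<in> I \<Longrightarrow> t i \<in> carrier (S i) \<and>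
      t i \<otimes>\<^bsub>S i\<^esub> s i = \<one>\<^bsub>S i\<^esub> \<and> s i \<otimes>\<^bsub>S i\<^esub> t i = \<one>\<^bsub>S i\<^esub>"
    using PiE_mem[OF assms] unfolding Units_def by simp metis
  have "s \<in> carrier (product_semiring I S)"
    using assms by (auto simp: product_semiring_simps PiE_iff Units_def)
  moreover have "restrict t I \<in> carrier (product_semiring I S)"
    using t by (simp add: product_semiring_simps)
  moreover have "restrict t I \<otimes>\<^bsub>product_semiring I S\<^esub> s = \<one>\<^bsub>product_semiring I S\<^esub>"
    and "s \<otimes>\<^bsub>product_semiring I S\<^esub> restrict t I = \<one>\<^bsub>product_semiring I S\<^esub>"
    using t by (auto simp: product_semiring_simps intro!: restrict_ext)
  ultimately show ?thesis
    unfolding Units_def by blast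
qed

text \<open>The annihilator is supported at the single coordinate \<open>j\<close>: away from \<open>j\<close> its entries are
  \<open>\<zero>\<close>, which annihilates every element of a semiring, and its entry at \<open>j\<close> keeps it nonzero.\<close>

lemma zero_divisor_product_semiringI:
  assumes S: "\<And>i. i \<in> I \<Longrightarrow> semiring (S i)"
    and s: "s \<in> carrier (product_semiring I S)"
    and j: "j \<in> I" "zero_divisor (S j) (s j)"
  shows "zero_divisor (product_semiring I S) s"
proof -
  obtain x where x: "x \<in> carrier (S j)" "x \<noteq> \<zero>\<^bsub>S j\<^esub>" "s j \<otimes>\<^bsub>S j\<^esub> x = \<zero>\<^bsub>S j\<^esub>"
    using j(2) unfolding zero_divisor_def by blast
  let ?y = "\<lambda>i\<in>I. if i = j then x else \<zero>\<^bsub>S i\<^esub>"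
  have "\<zero>\<^bsub>S i\<^esub> \<in> carrier (S i)" if "i \<in> I" for i
    using semiring.axioms(1)[OF S[OF that]] by (rule abelian_monoid.zero_closed)
  then have "?y \<in> carrier (product_semiring I S)"
    using x(1) by (auto simp: product_semiring_simps)
  moreover have "?y \<noteq> \<zero>\<^bsub>product_semiring I S\<^esub>"
    using j(1) x(2) by (auto simp: product_semiring_simps dest: fun_cong[of _ _ j])
  moreover have "s \<otimes>\<^bsub>product_semiring I S\<^esub> ?y = \<zero>\<^bsub>product_semiring I S\<^esub>"
    using s x(3) by (auto simp: product_semiring_simps PiE_carrier_mem semiring.r_null[OF S]
        intro!: restrict_ext)
  ultimately show ?thesis
    using s unfolding zero_divisor_def by blast
qed

theorem theorem3p6:
  fixes \<Lambda> :: "'i set" and S :: "'i \<Rightarrow> ('a, 'm) ring_scheme"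
  assumes "\<And>i. i \<in> \<Lambda> \<Longrightarrow> classical_semiring (S i)"
  shows "classical_semiring (product_semiring \<Lambda> S)"
proof -
  have S: "semiring (S i)" "comm_monoid (S i)" if "i \<in> \<Lambda>" for i
    using classical_semiring.axioms[OF assms[OF that]] by auto
  have "s \<in> Units (product_semiring \<Lambda> S) \<or> zero_divisor (product_semiring \<Lambda> S) s"
    if s: "s \<in> carrier (product_semiring \<Lambda> S)" for s
  proof (cases "\<forall>i\<in>\<Lambda>. s i \<in> Units (S i)")
    case True
    then have "s \<in> (\<Pi>\<^sub>E i\<in>\<Lambda>. Units (S i))"
      using s by (simp add: product_semiring_simps PiE_iff)
    then show ?thesis
      by (blast intro: Units_product_semiringI)
  next
    case False
    then obtain j where j: "j \<in> \<Lambda>" "s j \<notin> Units (S j)"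
      by blast
    moreover have "s j \<in> carrier (S j)"
      using s j(1) by (simp add: product_semiring_simps PiE_carrier_mem)
    ultimately have "zero_divisor (S j) (s j)"
      using classical_semiring.unit_or_zero_divisor[OF assms] by blast
    then show ?thesis
      using zero_divisor_product_semiringI[of \<Lambda> S s j] S(1) s j(1) by blast
  qed
  then show ?thesis
    using semiring_product_semiring[of \<Lambda> S] comm_monoid_product_semiring[of \<Lambda> S] S
    by (intro classical_semiring.intro classical_semiring_axioms.intro) auto
qed

end
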